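(* Let $u_0\in L^1(\mathbb{R})\cap L^{\infty}(\mathbb{R})$ be real-valued with $\|u_0\|_{L^1}\neq 0$, and suppose that $$\int_{\mathbb{R}} e^{\lambda y}|u_0(y)|\,dy<\infty\quad\text{for all }\lambda\in\mathbb{R}.$$ Assume that $\mathcal{N}(U_0)\neq\emptyset$. Then for every $\eta^{*}\in\mathcal{N}(U_0)$ with multiplicity $k\in\mathbb{N}$, there exist $T>0$ and points $x^{*}_j(t)\in\mathcal{Z}(t)$ ($j=1,\ldots,k$), defined for all $t>T$, such that for each $j=1,\ldots,k$ $$x^{*}_j(t)=2t\eta^{*}+2\sqrt{t}\,h_j+\frac{U_0^{(k+1)}(\eta^{*})}{(k+1)\,U_0^{(k)}(\eta^{*})}+o(1)\qquad(t\to+\infty),$$ where $h_1,\ldots,h_k$ are the mutually different zeros of the Hermite polynomial $H_k$ of order $k$.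
   Context: Let $u$ be the unique bounded solution of the one-dimensional heat equation $\partial_t u=\partial_x^2 u$ ($t>0$, $x\in\mathbb{R}$) with $u(0,x)=u_0(x)$, i.e. $u(t,x)=\int_{\mathbb{R}}G(t,x-y)u_0(y)\,dy$ with $G(t,x)=(4\pi t)^{-1/2}e^{-x^2/(4t)}$. The zero level set is $\mathcal{Z}(t):=\{x\in\mathbb{R}\mid u(t,x)=0\}$. The bilateral Laplace transform of $u_0$ is $U_0(\eta):=\int_{\mathbb{R}}e^{\eta y}u_0(y)\,dy$, $\eta\in\mathbb{R}$, and $\mathcal{N}(U_0):=\{\eta\in\mathbb{R}\mid U_0(\eta)=0\}$. A point $\eta^{*}\in\mathcal{N}(U_0)$ has multiplicity $k\in\mathbb{N}=\{1,2,\ldots\}$ if $U_0^{(m)}(\eta^{*})=0$ for all $0\le m<k$ and $U_0^{(k)}(\eta^{*})\neq 0$. The Hermite polynomial of order $k$ is $H_k(x):=(-1)^k e^{x^2}\frac{d^k}{dx^k}\left[e^{-x^2}\right]$. *)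

theory Defs
  imports "HOL-Analysis.Analysis" "HOL-Library.Landau_Symbols"
begin

definition heat_kernel :: "real \<Rightarrow> real \<Rightarrow> real" where
  "heat_kernel t x = exp (- x\<^sup>2 / (4 * t)) / sqrt (4 * pi * t)"

(* Meaningful for t > 0 only. For bounded u0 this is the unique bounded solution of the
   one-dimensional heat equation with initial datum u0. *)
definition heat_solution :: "(real \<Rightarrow> real) \<Rightarrow> real \<Rightarrow> real \<Rightarrow> real" where
  "heat_solution u0 t x = (LINT y|lebesgue. heat_kernel t (x - y) * u0 y)"

definition zero_level_set :: "(real \<Rightarrow> real) \<Rightarrow> real \<Rightarrow> real set" where
  "zero_level_set u0 t = {x. heat_solution u0 t x = 0}"

definition bilateral_laplace :: "(real \<Rightarrow> real) \<Rightarrow> real \<Rightarrow> real" where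
  "bilateral_laplace u0 \<eta> = (LINT y|lebesgue. exp (\<eta> * y) * u0 y)"

definition zero_set :: "(real \<Rightarrow> real) \<Rightarrow> real set" where
  "zero_set f = {\<eta>. f \<eta> = 0}"

definition has_multiplicity :: "(real \<Rightarrow> real) \<Rightarrow> real \<Rightarrow> nat \<Rightarrow> bool" where
  "has_multiplicity f \<eta> k \<longleftrightarrow>
     k \<ge> 1 \<and> (\<forall>m<k. (deriv ^^ m) f \<eta> = 0) \<and> (deriv ^^ k) f \<eta> \<noteq> 0"

definition hermite :: "nat \<Rightarrow> real \<Rightarrow> real" where
  "hermite k x = (-1) ^ k * exp (x\<^sup>2) * (deriv ^^ k) (\<lambda>z. exp (- z\<^sup>2)) x"

end

theory Submission
  imports Defs "HOL-Computational_Algebra.Polynomial"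
begin

text \<open>
  Put \<open>x = 2 t \<eta> + 2 \<surd>t z\<close> and \<open>s = 1 / (2 \<surd>t)\<close>. Completing the square, \<open>u(t,x)\<close> is a positive multiple of
  \<open>\<integral> e\<^sup>\<eta>\<^sup>y u\<^sub>0(y) exp(2 z (s y) - (s y)\<^sup>2) dy\<close>. The exponential is the generating function of the Hermite
  polynomials, so this integral is \<open>\<Sum>\<^sub>m H\<^sub>m(z) s\<^sup>m M\<^sub>m / m!\<close> with \<open>M\<^sub>m\<close> the derivatives of the Laplace
  transform at \<open>\<eta>\<close>, of which the first \<open>k\<close> vanish. At \<open>z = h + b s\<close> with \<open>H\<^sub>k(h) = 0\<close>, using
  \<open>H\<^sub>k\<^sub>+\<^sub>1(h) = - H\<^sub>k'(h)\<close>, the leading term is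
  \<open>s\<^sup>k\<^sup>+\<^sup>1 H\<^sub>k'(h) (b M\<^sub>k / k! - M\<^sub>k\<^sub>+\<^sub>1 / (k+1)!)\<close>; it changes sign at \<open>b = M\<^sub>k\<^sub>+\<^sub>1 / ((k+1) M\<^sub>k)\<close>, and the
  intermediate value theorem yields a zero of \<open>u\<close> nearby.
\<close>


section \<open>Hermite polynomials: recurrence, derivative and simplicity of roots\<close>

text \<open>This recurrence, rather than the three-term one, is what a single differentiation of
  \<open>H_n(x) exp(-x^2)\<close> produces, so it matches the iterated \<open>deriv\<close> in
  \<open>hermite\<close> step by step.\<close>

fun hermite_poly :: "nat \<Rightarrow> real poly" where
  "hermite_poly 0 = 1"
| "hermite_poly (Suc n) = [:0, 2:] * hermite_poly n - pderiv (hermite_poly n)"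

lemma hermite_poly_derivative:
  "((\<lambda>x. poly (hermite_poly n) x * exp (- x\<^sup>2)) has_real_derivative
     - (poly (hermite_poly (Suc n)) x * exp (- x\<^sup>2))) (at x)"
  by (auto intro!: derivative_eq_intros simp: algebra_simps)

lemma hermite_eq_poly: "hermite n x = poly (hermite_poly n) x"
proof -
  have "(deriv ^^ n) (\<lambda>z. exp (- z\<^sup>2)) = (\<lambda>x. (-1) ^ n * (poly (hermite_poly n) x * exp (- x\<^sup>2)))"
  proof (induction n)
    case (Suc n)
    have "deriv (\<lambda>x. (-1) ^ n * (poly (hermite_poly n) x * exp (- x\<^sup>2))) x
      = (-1) ^ Suc n * (poly (hermite_poly (Suc n)) x * exp (- x\<^sup>2))" for x
      by (rule DERIV_imp_deriv)
        (use DERIV_cmult[OF hermite_poly_derivative, of "(-1) ^ n" n x] in simp)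
    then show ?case
      using Suc by simp
  qed simp
  then show ?thesis
    by (simp add: hermite_def exp_minus field_simps flip: power_mult_distrib)
qed

text \<open>Differentiate the recurrence. By induction both derivative terms become multiples of the
  recurrence one order lower, which reassemble into \<open>hermite_poly (Suc n)\<close>.\<close>

lemma pderiv_hermite_poly:
  "pderiv (hermite_poly (Suc n)) = smult (2 * real (Suc n)) (hermite_poly n)"
proof (induction n)
  case 0
  show ?case by (simp add: pderiv_pCons pderiv_diff)
next
  case (Suc n)
  let ?H = "hermite_poly (Suc n)"
  have "pderiv (hermite_poly (Suc (Suc n))) = pderiv ([:0, 2:] * ?H - pderiv ?H)"
    by simp
  also have "\<dots> = [:2:] * ?H + [:0, 2:] * pderiv ?H - pderiv (pderiv ?H)"
    unfolding pderiv_diff pderiv_mult by (simp add: pderiv_pCons)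
  also have "\<dots> = [:2:] * ?H + smult (2 * real (Suc n)) ([:0, 2:] * hermite_poly n - pderiv (hermite_poly n))"
    unfolding Suc pderiv_smult by (simp add: smult_diff_right)
  also have "\<dots> = smult (2 * real (Suc (Suc n))) ?H"
    unfolding hermite_poly.simps(2)[of n, symmetric]
    by (simp del: hermite_poly.simps flip: smult_add_left)
  finally show ?case .
qed

lemma hermite_poly_nonzero: "hermite_poly n \<noteq> 0"
proof (induction n)
  case (Suc n)
  then show ?case
    using pderiv_hermite_poly[of n] by (auto simp del: hermite_poly.simps)
qed simp

lemma degree_hermite_poly: "degree (hermite_poly n) \<le> n"
proof (induction n)
  case (Suc n)
  have "degree ([:0, 2:] * hermite_poly n) \<le> Suc n"
    using degree_mult_le[of "[:0, 2::real:]" "hermite_poly n"] Suc by simp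
  moreover have "degree (pderiv (hermite_poly n)) \<le> Suc n"
    using Suc by (simp add: degree_pderiv)
  ultimately show ?case
    unfolding hermite_poly.simps by (rule degree_diff_le)
qed simp

text \<open>Two consecutive polynomials vanishing at \<open>x\<close> would force the previous one
  to vanish there too, through the recurrence and the derivative formula; the descent ends at
  \<open>H_0 = 1\<close>. Since \<open>H_(n+1) = - H_n'\<close> at a root of \<open>H_n\<close>,
  this says that all roots are simple.\<close>

lemma hermite_poly_no_common_root:
  assumes "poly (hermite_poly n) x = 0"
  shows "poly (hermite_poly (Suc n)) x \<noteq> 0"
  using assms
proof (induction n)
  case (Suc n)
  show ?case
  proof
    assume "poly (hermite_poly (Suc (Suc n))) x = 0"
    with Suc.prems have "poly (pderiv (hermite_poly (Suc n))) x = 0"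
      by (simp add: hermite_poly.simps(2)[of "Suc n"] del: hermite_poly.simps)
    then have "poly (hermite_poly n) x = 0"
      unfolding pderiv_hermite_poly by simp
    then show False
      using Suc by blast
  qed
qed simp

section \<open>Counting the real roots of Hermite polynomials by Rolle's theorem\<close>

text \<open>Each factor \<open>x\<close> in the Horner form of \<open>p\<close> is paid for with
  half of the Gaussian; hence \<open>c\<close> is arbitrary in the induction.\<close>

lemma poly_gaussian_bounded:
  fixes p :: "real poly"
  assumes "c > 0"
  shows "\<exists>B. \<forall>x. \<bar>poly p x * exp (- c * x\<^sup>2)\<bar> \<le> B"
  using assms
proof (induction p arbitrary: c)
  case (pCons a p)
  obtain B where B: "\<And>x. \<bar>poly p x * exp (- (c / 2) * x\<^sup>2)\<bar> \<le> B"
    using pCons.IH[of "c / 2"] pCons.prems by auto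
  have lin: "\<bar>x * exp (- (c / 2) * x\<^sup>2)\<bar> \<le> 1 + 2 / c" for x
  proof -
    have "\<bar>x\<bar> \<le> 1 + x\<^sup>2"
      using zero_le_power2[of "\<bar>x\<bar> - 1 / 2"] zero_le_power2[of x]
      by (simp add: power2_diff power_divide)
    \<comment> \<open>The product expands to \<open>1 + x^2 + 2 / c + c / 2 * x^2\<close>; its
      second factor is of the form \<open>1 + r\<close>, ready for the bound by
      \<open>exp r\<close>.\<close>
    also have "\<dots> \<le> (1 + 2 / c) * (1 + c / 2 * x\<^sup>2)"
      using pCons.prems by (simp add: field_simps)
    also have "\<dots> \<le> (1 + 2 / c) * exp (c / 2 * x\<^sup>2)"
      using pCons.prems by (intro mult_left_mono exp_ge_add_one_self) auto
    finally show ?thesis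
      by (simp add: abs_mult exp_minus field_simps)
  qed
  have "\<bar>poly (pCons a p) x * exp (- c * x\<^sup>2)\<bar> \<le> \<bar>a\<bar> + (1 + 2 / c) * B" for x
  proof -
    have "exp (- c * x\<^sup>2) = exp (- (c / 2) * x\<^sup>2) * exp (- (c / 2) * x\<^sup>2)"
      by (simp flip: exp_add)
    then have "poly (pCons a p) x * exp (- c * x\<^sup>2) = a * exp (- c * x\<^sup>2)
        + (x * exp (- (c / 2) * x\<^sup>2)) * (poly p x * exp (- (c / 2) * x\<^sup>2))"
      by (simp add: algebra_simps)
    also have "\<bar>\<dots>\<bar> \<le> \<bar>a * exp (- c * x\<^sup>2)\<bar>
        + \<bar>x * exp (- (c / 2) * x\<^sup>2)\<bar> * \<bar>poly p x * exp (- (c / 2) * x\<^sup>2)\<bar>"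
      unfolding abs_mult[symmetric] by (rule abs_triangle_ineq)
    also have "\<dots> \<le> \<bar>a\<bar> + (1 + 2 / c) * B"
    proof (intro add_mono mult_mono lin B)
      show "\<bar>a * exp (- c * x\<^sup>2)\<bar> \<le> \<bar>a\<bar>"
        using pCons.prems by (simp add: abs_mult mult_left_le)
    qed (use pCons.prems in auto)
    finally show ?thesis .
  qed
  then show ?case by blast
qed auto

lemma poly_gaussian_tendsto_0:
  fixes p :: "real poly"
  shows "((\<lambda>x. poly p x * exp (- x\<^sup>2)) \<longlongrightarrow> 0) at_infinity"
proof -
  \<comment> \<open>\<open>pCons 0 p\<close> is \<open>x * p(x)\<close>: a bound on it gives decay
    of order \<open>1 / x\<close> for \<open>p\<close> itself.\<close>
  obtain B where B: "\<And>x. \<bar>poly (pCons 0 p) x * exp (- x\<^sup>2)\<bar> \<le> B"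
    using poly_gaussian_bounded[of 1 "pCons 0 p"] by auto
  show ?thesis
  proof (rule Lim_null_comparison)
    show "\<forall>\<^sub>F x in at_infinity. norm (poly p x * exp (- x\<^sup>2)) \<le> norm (B * inverse x)"
      unfolding eventually_at_infinity
    proof (intro exI allI impI)
      fix x :: real assume "norm x \<ge> 1"
      then show "norm (poly p x * exp (- x\<^sup>2)) \<le> norm (B * inverse x)"
        using B[of x] by (simp add: abs_mult field_simps)
    qed
    show "((\<lambda>x. norm (B * inverse x)) \<longlongrightarrow> 0) (at_infinity :: real filter)"
      by (intro tendsto_norm_zero tendsto_mult_right_zero tendsto_inverse_0)
  qed
qed

text \<open>Rolle's theorem on a half-line, with the limit 0 at infinity in the role of the second
  zero. If \<open>f\<close> vanishes identically beyond \<open>a\<close>, any point there will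
  do.\<close>

lemma critical_point_right_of_zero:
  fixes f :: "real \<Rightarrow> real"
  assumes der: "\<And>x. (f has_real_derivative f' x) (at x)"
    and lim: "(f \<longlongrightarrow> 0) at_top" and "f a = 0"
  shows "\<exists>x>a. f' x = 0"
proof (cases "\<exists>y>a. f y \<noteq> 0")
  case True
  then obtain y where y: "y > a" "f y \<noteq> 0" by blast
  have cont: "continuous_on S f" for S
    using der by (intro continuous_at_imp_continuous_on) (auto intro: DERIV_isCont)
  have diff: "f differentiable (at x)" for x
    using der real_differentiable_def by blast
  have "eventually (\<lambda>x. \<bar>f x\<bar> < \<bar>f y\<bar> / 2) at_top"
    using tendstoD[OF lim, of "\<bar>f y\<bar> / 2"] y by (simp add: dist_real_def)
  then obtain z where z: "z > y" "\<bar>f z\<bar> < \<bar>f y\<bar> / 2"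
    using eventually_happens'[OF _ eventually_conj[OF eventually_gt_at_top[of y]]] by auto
  \<comment> \<open>The value \<open>f y / 2\<close> lies strictly between 0 and \<open>f y\<close>,
    so it is taken once between \<open>a\<close> and \<open>y\<close> and once more between
    \<open>y\<close> and \<open>z\<close>; ordinary Rolle applies to these two points.\<close>
  have "\<exists>p\<ge>a. p \<le> y \<and> f p = f y / 2"
  proof (cases "f y > 0")
    case True
    then show ?thesis using y assms(3) cont by (intro IVT') auto
  next
    case False
    then show ?thesis using y assms(3) cont by (intro IVT2') auto
  qed
  then obtain p where p: "a \<le> p" "p \<le> y" "f p = f y / 2" by blast
  have "\<exists>q\<ge>y. q \<le> z \<and> f q = f y / 2"
  proof (cases "f y > 0")
    case True
    then show ?thesis using z cont by (intro IVT2') auto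
  next
    case False
    then show ?thesis using z cont by (intro IVT') auto
  qed
  then obtain q where q: "y \<le> q" "f q = f y / 2" by blast
  have "p \<noteq> y" "q \<noteq> y"
    using p q y by auto
  then have "p < q"
    using p q by linarith
  then obtain x where "p < x" "(f has_real_derivative 0) (at x)"
    using Rolle[of p q f] p q cont diff by auto
  then show ?thesis
    using p der DERIV_unique by (metis order.strict_trans1)
next
  case False
  then have "\<forall>\<^sub>F x in nhds (a + 1). f x = 0"
    by (intro eventually_mono[OF eventually_nhds_in_open[of "{a<..}"]]) auto
  then have "(f has_real_derivative 0) (at (a + 1))"
    by (subst DERIV_cong_ev[OF refl _ refl]) auto
  then show ?thesis
    using DERIV_unique[OF der] by (intro exI[of _ "a + 1"]) auto
qed

text \<open>Rolle gives a critical point in each gap between consecutive zeros, and the decay at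
  infinity gives one more beyond each of the two extreme zeros: \<open>card A - 1 + 2\<close> in
  total.\<close>

lemma card_critical_points:
  fixes f :: "real \<Rightarrow> real"
  assumes der: "\<And>x. (f has_real_derivative f' x) (at x)"
    and lim: "(f \<longlongrightarrow> 0) at_top" "(f \<longlongrightarrow> 0) at_bot"
    and A: "finite A" "A \<noteq> {}" "\<And>x. x \<in> A \<Longrightarrow> f x = 0"
  shows "\<exists>B. finite B \<and> card B = Suc (card A) \<and> (\<forall>x\<in>B. f' x = 0)"
proof -
  have cont: "continuous_on S f" for S
    using der by (intro continuous_at_imp_continuous_on) (auto intro: DERIV_isCont)
  have diff: "f differentiable (at x)" for x
    using der real_differentiable_def by blast
  \<comment> \<open>The gaps and the right end come first, adding zeros from right to left. The
    bound \<open>Min A < x\<close> keeps the point found in a new leftmost gap distinct from the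
    earlier ones; the empty set is split off because it has no minimum.\<close>
  have "A = {} \<or> (\<exists>B. finite B \<and> card B = card A \<and> (\<forall>x\<in>B. Min A < x \<and> f' x = 0))"
    using A(1,3)
  proof (induction rule: finite_linorder_min_induct)
    case (insert b A)
    show ?case
    proof (cases "A = {}")
      case True
      obtain x where "x > b" "f' x = 0"
        using critical_point_right_of_zero[OF der lim(1)] insert.prems by blast
      then show ?thesis
        using True by (intro disjI2 exI[of _ "{x}"]) auto
    next
      case False
      then obtain B where B: "finite B" "card B = card A" "\<forall>x\<in>B. Min A < x \<and> f' x = 0"
        using insert by auto
      have "Min A \<in> A" using False insert by simp
      then obtain x where x: "b < x" "x < Min A" "(f has_real_derivative 0) (at x)"
        using Rolle[of b "Min A" f] insert.prems insert.hyps cont diff by auto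
      then have "f' x = 0" using der DERIV_unique by blast
      moreover have "Min (insert b A) = b"
        using insert by (intro Min_eqI) auto
      moreover have "x \<notin> B" "b \<notin> A" using B x insert by auto
      ultimately show ?thesis
        using B x insert.hyps by (intro disjI2 exI[of _ "insert x B"]) auto
    qed
  qed simp
  with A obtain B where B: "finite B" "card B = card A" "\<forall>x\<in>B. Min A < x \<and> f' x = 0"
    by blast
  \<comment> \<open>Reflection turns the left end into a right end and supplies the critical point
    below \<open>Min A\<close>.\<close>
  have "((\<lambda>x. f (- x)) has_real_derivative - f' (- x)) (at x)" for x
    using DERIV_mirror der by blast
  moreover have "((\<lambda>x. f (- x)) \<longlongrightarrow> 0) at_top"
    using lim(2) by (simp add: filterlim_at_bot_mirror)
  moreover have "f (- (- Min A)) = 0" using A(3)[OF Min_in[OF A(1,2)]] by simp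
  ultimately obtain x where "x > - Min A" "- f' (- x) = 0"
    using critical_point_right_of_zero[of "\<lambda>x. f (- x)" "\<lambda>x. - f' (- x)" "- Min A"] by blast
  then show ?thesis
    using B by (intro exI[of _ "insert (- x) B"]) (auto simp: card_insert_if)
qed

text \<open>The degree bounds the number of roots from above. From below, \<open>n\<close> zeros of
  \<open>H_n(x) exp(-x^2)\<close> yield \<open>n + 1\<close> critical points, which are zeros of
  \<open>H_(n+1)\<close>.\<close>

lemma card_roots_hermite_poly: "card {x. poly (hermite_poly n) x = 0} = n"
proof (rule antisym)
  show "card {x. poly (hermite_poly n) x = 0} \<le> n"
    using card_poly_roots_bound[OF hermite_poly_nonzero, of n] degree_hermite_poly[of n] by simp
  have "\<exists>A. finite A \<and> card A = n \<and> (\<forall>x\<in>A. poly (hermite_poly n) x = 0)"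
  proof (induction n)
    case (Suc n)
    show ?case
    \<comment> \<open>\<open>H_0\<close> has no zero from which to start the Rolle argument, so the
      root 0 of \<open>H_1(x) = 2 x\<close> is given directly.\<close>
    proof (cases "n = 0")
      case False
      let ?f = "\<lambda>x. poly (hermite_poly n) x * exp (- x\<^sup>2)"
      obtain A where A: "finite A" "card A = n" "\<forall>x\<in>A. poly (hermite_poly n) x = 0"
        using Suc by blast
      have "(?f \<longlongrightarrow> 0) at_top" "(?f \<longlongrightarrow> 0) at_bot"
        by (rule filterlim_mono[OF poly_gaussian_tendsto_0]; simp add: at_top_le_at_infinity at_bot_le_at_infinity)+
      moreover have "A \<noteq> {}" "\<And>x. x \<in> A \<Longrightarrow> ?f x = 0"
        using A False by auto
      ultimately obtain B where "finite B" "card B = Suc (card A)"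
        "\<forall>x\<in>B. - (poly (hermite_poly (Suc n)) x * exp (- x\<^sup>2)) = 0"
        using card_critical_points[OF hermite_poly_derivative[of n] _ _ A(1)] by blast
      then show ?thesis
        using A(2) by (auto simp del: hermite_poly.simps)
    qed (auto intro!: exI[of _ "{0}"] simp: pderiv_1)
  qed (auto intro: exI[of _ "{}"])
  then obtain A where "finite A" "card A = n" "A \<subseteq> {x. poly (hermite_poly n) x = 0}"
    by blast
  then show "n \<le> card {x. poly (hermite_poly n) x = 0}"
    using card_mono[OF poly_roots_finite[OF hermite_poly_nonzero]] by blast
qed

section \<open>Uniform Taylor bound for the Hermite generating function\<close>

text \<open>The Lagrange remainder is controlled for all \<open>x\<close>, not only small ones, because every derivative
  of \<open>x \<mapsto> exp (2 z x - x\<^sup>2)\<close> is \<open>exp (z\<^sup>2)\<close> times a polynomial times a Gaussian in \<open>z - x\<close>.\<close>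

lemma hermite_taylor:
  "\<exists>B. \<forall>z x. \<bar>exp (2 * z * x - x\<^sup>2) - (\<Sum>m<n. poly (hermite_poly m) z / fact m * x ^ m)\<bar>
     \<le> exp (z\<^sup>2) * B * \<bar>x\<bar> ^ n"
proof -
  obtain B where B: "\<And>x. \<bar>poly (hermite_poly n) x * exp (- x\<^sup>2)\<bar> \<le> B"
    using poly_gaussian_bounded[of 1 "hermite_poly n"] by auto
  \<comment> \<open>\<open>D z m\<close> is the \<open>m\<close>-th derivative of
    \<open>x \<mapsto> exp (2 * z * x - x^2)\<close>; at \<open>x = 0\<close> it equals
    \<open>H_m(z)\<close>, the Taylor coefficient up to the factorial.\<close>
  define D where "D z m x = poly (hermite_poly m) (z - x) * exp (2 * z * x - x\<^sup>2)"
    for z x :: real and m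
  have der: "(D z m has_real_derivative D z (Suc m) x) (at x)" for z m x
    unfolding D_def
    by (auto intro!: derivative_eq_intros simp: algebra_simps)
  show ?thesis
  proof (intro exI allI)
    fix z x :: real
    obtain \<xi> where "exp (2 * z * x - x\<^sup>2) = (\<Sum>m<n. D z m 0 / fact m * x ^ m) + D z n \<xi> / fact n * x ^ n"
      using Maclaurin_all_le[of "D z" "\<lambda>x. exp (2 * z * x - x\<^sup>2)" x n] der
      by (auto simp: D_def fun_eq_iff)
    then have "\<bar>exp (2 * z * x - x\<^sup>2) - (\<Sum>m<n. poly (hermite_poly m) z / fact m * x ^ m)\<bar>
        = \<bar>D z n \<xi>\<bar> / fact n * \<bar>x\<bar> ^ n"
      by (simp add: D_def abs_mult power_abs)
    also have "\<dots> \<le> \<bar>D z n \<xi>\<bar> * \<bar>x\<bar> ^ n"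
      by (intro mult_right_mono) (auto simp: divide_le_eq mult_le_cancel_left1 fact_ge_1)
    also have "D z n \<xi> = exp (z\<^sup>2) * (poly (hermite_poly n) (z - \<xi>) * exp (- (z - \<xi>)\<^sup>2))"
      by (simp add: D_def power2_eq_square algebra_simps flip: exp_add)
    also have "\<bar>\<dots>\<bar> * \<bar>x\<bar> ^ n \<le> exp (z\<^sup>2) * B * \<bar>x\<bar> ^ n"
      using B by (intro mult_right_mono) (auto simp: abs_mult)
    finally show "\<bar>exp (2 * z * x - x\<^sup>2) - (\<Sum>m<n. poly (hermite_poly m) z / fact m * x ^ m)\<bar>
        \<le> exp (z\<^sup>2) * B * \<bar>x\<bar> ^ n" .
  qed
qed

section \<open>Exponential moments and derivatives of the bilateral Laplace transform\<close>

text \<open>This class is closed under multiplication by powers of \<open>y\<close> and by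
  Gaussians, so one differentiation lemma can be iterated and also applied to the Gaussian-damped
  datum.\<close>

definition all_exp_moments :: "(real \<Rightarrow> real) \<Rightarrow> bool" where
  "all_exp_moments v \<longleftrightarrow> v \<in> borel_measurable lebesgue \<and>
     (\<forall>c. integrable lebesgue (\<lambda>y. exp (c * y) * \<bar>v y\<bar>))"

lemma borel_measurable_lebesgueI:
  fixes f :: "real \<Rightarrow> real"
  shows "f \<in> borel_measurable borel \<Longrightarrow> f \<in> borel_measurable lebesgue"
  by (rule measurable_completion) simp

lemma exp_measurable_lebesgue [measurable]: "(\<lambda>y::real. exp (c * y)) \<in> borel_measurable lebesgue"
  by (rule borel_measurable_lebesgueI) measurable

lemma all_exp_moments_measurable [measurable_dest]:
  "all_exp_moments v \<Longrightarrow> v \<in> borel_measurable lebesgue"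
  by (simp add: all_exp_moments_def)

lemma all_exp_moments_integrable:
  assumes "all_exp_moments v"
  shows "integrable lebesgue (\<lambda>y. exp (c * y) * \<bar>v y\<bar>)"
    and "integrable lebesgue (\<lambda>y. exp (c * y) * v y)"
proof -
  show *: "integrable lebesgue (\<lambda>y. exp (c * y) * \<bar>v y\<bar>)"
    using assms by (simp add: all_exp_moments_def)
  show "integrable lebesgue (\<lambda>y. exp (c * y) * v y)"
    by (rule Bochner_Integration.integrable_bound[OF *]) (use assms in \<open>auto simp: abs_mult\<close>)
qed

lemma exp_abs_le: "exp \<bar>x\<bar> \<le> exp x + exp (- x :: real)"
  by (cases "x \<ge> 0") auto

text \<open>A factor \<open>y\<close> costs at most \<open>exp y + exp (- y)\<close>, which only
  shifts the weight \<open>c\<close> to \<open>c + 1\<close> and \<open>c - 1\<close>.\<close>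

lemma all_exp_moments_times_id:
  assumes "all_exp_moments v"
  shows "all_exp_moments (\<lambda>y. y * v y)"
  unfolding all_exp_moments_def
proof (intro conjI allI)
  show meas: "(\<lambda>y. y * v y) \<in> borel_measurable lebesgue"
    using assms by (intro borel_measurable_times) (auto simp: all_exp_moments_def intro: borel_measurable_lebesgueI)
  fix c
  show "integrable lebesgue (\<lambda>y. exp (c * y) * \<bar>y * v y\<bar>)"
  proof (rule Bochner_Integration.integrable_bound)
    show "integrable lebesgue (\<lambda>y. exp ((c + 1) * y) * \<bar>v y\<bar> + exp ((c - 1) * y) * \<bar>v y\<bar>)"
      using assms by (intro Bochner_Integration.integrable_add all_exp_moments_integrable)
    have "exp (c * y) * \<bar>y * v y\<bar> \<le> exp ((c + 1) * y) * \<bar>v y\<bar> + exp ((c - 1) * y) * \<bar>v y\<bar>" for y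
    proof -
      have "\<bar>y\<bar> \<le> exp y + exp (- y)"
        using exp_ge_add_one_self[of "\<bar>y\<bar>"] exp_abs_le[of y] by linarith
      then have "exp (c * y) * \<bar>v y\<bar> * \<bar>y\<bar> \<le> exp (c * y) * \<bar>v y\<bar> * (exp y + exp (- y))"
        by (intro mult_left_mono) auto
      then show ?thesis
        by (simp add: abs_mult algebra_simps flip: exp_add)
    qed
    then show "AE y in lebesgue. norm (exp (c * y) * \<bar>y * v y\<bar>)
        \<le> norm (exp ((c + 1) * y) * \<bar>v y\<bar> + exp ((c - 1) * y) * \<bar>v y\<bar>)"
      by (auto simp: abs_mult)
  qed (use meas in measurable)
qed

lemma all_exp_moments_times_power:
  "all_exp_moments v \<Longrightarrow> all_exp_moments (\<lambda>y. y ^ n * v y)"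
  by (induction n) (simp_all add: all_exp_moments_times_id mult.assoc)

lemma all_exp_moments_times_gaussian:
  assumes "all_exp_moments v"
  shows "all_exp_moments (\<lambda>y. exp (- (s * y)\<^sup>2) * v y)"
  unfolding all_exp_moments_def
proof (intro conjI allI)
  have g: "(\<lambda>y::real. exp (- (s * y)\<^sup>2)) \<in> borel_measurable lebesgue"
    by (rule borel_measurable_lebesgueI) measurable
  show meas: "(\<lambda>y. exp (- (s * y)\<^sup>2) * v y) \<in> borel_measurable lebesgue"
    using g assms by measurable
  fix c
  show "integrable lebesgue (\<lambda>y. exp (c * y) * \<bar>exp (- (s * y)\<^sup>2) * v y\<bar>)"
    by (rule Bochner_Integration.integrable_bound[OF all_exp_moments_integrable(1)[OF assms, of c]])
      (use meas in \<open>measurable, auto simp: abs_mult mult_left_le_one_le\<close>)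
qed

text \<open>Lagrange remainder of order two. The condition on \<open>h\<close> keeps the
  intermediate exponent below \<open>\<bar>y\<bar>\<close>, so the factor after \<open>h^2\<close>
  does not depend on \<open>h\<close>.\<close>

lemma exp_second_order_bound:
  fixes h y :: real
  assumes "\<bar>h\<bar> \<le> 1"
  shows "\<bar>exp (h * y) - 1 - h * y\<bar> \<le> h\<^sup>2 * (y\<^sup>2 * (exp y + exp (- y)))"
proof -
  obtain t where t: "\<bar>t\<bar> \<le> \<bar>h * y\<bar>" "exp (h * y) = (\<Sum>m<2. (h * y) ^ m / fact m) + exp t / fact 2 * (h * y)\<^sup>2"
    using Maclaurin_exp_le by blast
  have "\<bar>h * y\<bar> \<le> \<bar>y\<bar>"
    using assms by (simp add: abs_mult mult_left_le_one_le)
  then have "t \<le> \<bar>y\<bar>" using t(1) by linarith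
  then have "exp t \<le> exp y + exp (- y)"
    using exp_abs_le[of y] by (meson exp_le_cancel_iff order.trans)
  then have "exp t * (h * y)\<^sup>2 \<le> (exp y + exp (- y)) * (h * y)\<^sup>2"
    by (rule mult_right_mono) simp
  moreover have "0 \<le> exp t * (h * y)\<^sup>2"
    by simp
  moreover have "exp (h * y) - 1 - h * y = exp t * (h * y)\<^sup>2 / 2"
    using t(2) by (simp add: numeral_2_eq_2)
  ultimately have "\<bar>exp (h * y) - 1 - h * y\<bar> \<le> (exp y + exp (- y)) * (h * y)\<^sup>2"
    by linarith
  then show ?thesis
    by (simp only: power_mult_distrib mult_ac)
qed

text \<open>Integrating the second-order bound shows that the linearisation error is at most
  \<open>h^2\<close> times a fixed integral, so the difference quotient is off by
  \<open>O(h)\<close>.\<close>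

lemma bilateral_laplace_derivative:
  assumes v: "all_exp_moments v"
  shows "(bilateral_laplace v has_real_derivative bilateral_laplace (\<lambda>y. y * v y) \<eta>) (at \<eta>)"
proof -
  let ?U = "bilateral_laplace v" and ?D = "bilateral_laplace (\<lambda>y. y * v y) \<eta>"
  let ?w = "\<lambda>y. y * (y * v y)"
  let ?K = "\<lambda>y. exp ((\<eta> + 1) * y) * \<bar>?w y\<bar> + exp ((\<eta> - 1) * y) * \<bar>?w y\<bar>"
  note int = all_exp_moments_integrable[OF v]
    all_exp_moments_integrable[OF all_exp_moments_times_id[OF v]]
    all_exp_moments_integrable[OF all_exp_moments_times_id[OF all_exp_moments_times_id[OF v]]]
  have bound: "\<bar>?U (\<eta> + h) - ?U \<eta> - h * ?D\<bar> \<le> h\<^sup>2 * (LINT y|lebesgue. ?K y)" if "\<bar>h\<bar> \<le> 1" for h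
  proof -
    let ?E = "\<lambda>y. exp ((\<eta> + h) * y) * v y - exp (\<eta> * y) * v y - h * (exp (\<eta> * y) * (y * v y))"
    have eq: "?U (\<eta> + h) - ?U \<eta> - h * ?D = (LINT y|lebesgue. ?E y)"
      unfolding bilateral_laplace_def using int by simp
    have "\<bar>LINT y|lebesgue. ?E y\<bar> \<le> (LINT y|lebesgue. h\<^sup>2 * ?K y)"
    proof (rule order.trans[OF integral_abs_bound integral_mono])
      fix y
      have "?E y = exp (\<eta> * y) * v y * (exp (h * y) - 1 - h * y)"
        by (simp add: algebra_simps exp_add)
      then have "\<bar>?E y\<bar> = exp (\<eta> * y) * \<bar>v y\<bar> * \<bar>exp (h * y) - 1 - h * y\<bar>"
        by (simp add: abs_mult)
      also have "\<dots> \<le> exp (\<eta> * y) * \<bar>v y\<bar> * (h\<^sup>2 * (y\<^sup>2 * (exp y + exp (- y))))"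
        using that by (intro mult_left_mono exp_second_order_bound) auto
      also have "\<dots> = h\<^sup>2 * ?K y"
      proof -
        have "\<bar>?w y\<bar> = y\<^sup>2 * \<bar>v y\<bar>"
          by (simp add: abs_mult power2_eq_square flip: mult.assoc)
        moreover have "exp ((\<eta> + 1) * y) = exp (\<eta> * y) * exp y" "exp ((\<eta> - 1) * y) = exp (\<eta> * y) * exp (- y)"
          by (simp_all add: algebra_simps flip: exp_add)
        ultimately show ?thesis
          by (simp add: algebra_simps)
      qed
      finally show "\<bar>?E y\<bar> \<le> h\<^sup>2 * ?K y" .
    qed (use int in auto)
    also have "\<dots> = h\<^sup>2 * (LINT y|lebesgue. ?K y)"
      by (rule integral_mult_right_zero)
    finally show ?thesis
      unfolding eq .
  qed
  have "((\<lambda>h. (?U (\<eta> + h) - ?U \<eta>) / h - ?D) \<longlongrightarrow> 0) (at 0)"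
  proof (rule Lim_null_comparison)
    show "\<forall>\<^sub>F h in at 0. norm ((?U (\<eta> + h) - ?U \<eta>) / h - ?D) \<le> \<bar>h\<bar> * (LINT y|lebesgue. ?K y)"
      unfolding eventually_at
    proof (intro exI[of _ 1] conjI ballI impI)
      fix h :: real assume h: "h \<noteq> 0 \<and> dist h 0 < 1"
      then have "(?U (\<eta> + h) - ?U \<eta>) / h - ?D = (?U (\<eta> + h) - ?U \<eta> - h * ?D) / h"
        by (simp add: field_simps)
      then show "norm ((?U (\<eta> + h) - ?U \<eta>) / h - ?D) \<le> \<bar>h\<bar> * (LINT y|lebesgue. ?K y)"
        using bound[of h] h by (simp add: divide_le_eq power2_eq_square mult_ac)
    qed simp
    show "((\<lambda>h. \<bar>h\<bar> * (LINT y|lebesgue. ?K y)) \<longlongrightarrow> 0) (at 0)"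
      by (auto intro!: tendsto_eq_intros)
  qed
  then show ?thesis
    by (simp add: DERIV_def LIM_zero_iff)
qed

lemma higher_deriv_bilateral_laplace:
  "all_exp_moments v \<Longrightarrow>
     (deriv ^^ n) (bilateral_laplace v) = bilateral_laplace (\<lambda>y. y ^ n * v y)"
proof (induction n)
  case (Suc n)
  have "deriv (bilateral_laplace (\<lambda>y. y ^ n * v y)) = bilateral_laplace (\<lambda>y. y * (y ^ n * v y))"
    using bilateral_laplace_derivative[OF all_exp_moments_times_power[OF Suc.prems]]
    by (auto intro!: DERIV_imp_deriv)
  then show ?case
    using Suc by (simp add: mult.assoc)
qed simp

section \<open>The heat solution as a Laplace transform and its small-\<open>s\<close>
  expansion\<close>

text \<open>Completing the square. The prefactor is positive, so the zeros of the solution at time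
  \<open>t\<close> are those of the transform of the damped datum, evaluated at
  \<open>x / (2 * t)\<close>.\<close>

lemma heat_solution_eq_laplace:
  assumes "t > 0"
  shows "heat_solution u0 t x = exp (- x\<^sup>2 / (4 * t)) / sqrt (4 * pi * t) *
    bilateral_laplace (\<lambda>y. exp (- (1 / (2 * sqrt t) * y)\<^sup>2) * u0 y) (x / (2 * t))"
proof -
  have "heat_kernel t (x - y) = exp (- x\<^sup>2 / (4 * t)) / sqrt (4 * pi * t) *
      (exp (x / (2 * t) * y) * exp (- (1 / (2 * sqrt t) * y)\<^sup>2))" for y
  proof -
    have "- (x - y)\<^sup>2 / (4 * t) = - x\<^sup>2 / (4 * t) + (x / (2 * t) * y + - (1 / (2 * sqrt t) * y)\<^sup>2)"
      using assms by (simp add: power_mult_distrib power_divide power2_diff field_simps)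
    then show ?thesis
      unfolding heat_kernel_def by (simp only: exp_add) simp
  qed
  then show ?thesis
    unfolding heat_solution_def bilateral_laplace_def
    by (simp only: mult.assoc Bochner_Integration.integral_mult_right_zero)
qed

text \<open>The Taylor bound is used at \<open>x = s * y\<close> and integrated against
  \<open>exp (\<eta> * y) * v y\<close>; it holds for every \<open>y\<close>, so no splitting of the
  integral is needed. \<open>C\<close> depends on neither \<open>z\<close> nor \<open>s\<close>,
  hence \<open>z\<close> may later vary with \<open>s\<close>.\<close>

lemma gaussian_laplace_expansion:
  assumes v: "all_exp_moments v"
  shows "\<exists>C. \<forall>z s. \<bar>bilateral_laplace (\<lambda>y. exp (- (s * y)\<^sup>2) * v y) (\<eta> + 2 * z * s)
      - (\<Sum>m<n. poly (hermite_poly m) z / fact m * s ^ m * bilateral_laplace (\<lambda>y. y ^ m * v y) \<eta>)\<bar>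
    \<le> exp (z\<^sup>2) * C * \<bar>s\<bar> ^ n"
proof -
  obtain B where B: "\<And>z x. \<bar>exp (2 * z * x - x\<^sup>2) - (\<Sum>m<n. poly (hermite_poly m) z / fact m * x ^ m)\<bar>
      \<le> exp (z\<^sup>2) * B * \<bar>x\<bar> ^ n"
    using hermite_taylor by blast
  let ?K = "\<lambda>y. exp (\<eta> * y) * \<bar>y ^ n * v y\<bar>"
  note int = all_exp_moments_integrable[OF all_exp_moments_times_power[OF v]]
    all_exp_moments_integrable[OF all_exp_moments_times_gaussian[OF v]]
  show ?thesis
  proof (intro exI allI)
    fix z s :: real
    let ?S = "\<lambda>y. \<Sum>m<n. poly (hermite_poly m) z / fact m * s ^ m * (exp (\<eta> * y) * (y ^ m * v y))"
    let ?G = "\<lambda>y. exp ((\<eta> + 2 * z * s) * y) * (exp (- (s * y)\<^sup>2) * v y)"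
    have eq: "bilateral_laplace (\<lambda>y. exp (- (s * y)\<^sup>2) * v y) (\<eta> + 2 * z * s)
      - (\<Sum>m<n. poly (hermite_poly m) z / fact m * s ^ m * bilateral_laplace (\<lambda>y. y ^ m * v y) \<eta>)
      = (LINT y|lebesgue. ?G y - ?S y)"
      unfolding bilateral_laplace_def
      using int by (subst Bochner_Integration.integral_diff) auto
    have "\<bar>LINT y|lebesgue. ?G y - ?S y\<bar> \<le> (LINT y|lebesgue. exp (z\<^sup>2) * B * \<bar>s\<bar> ^ n * ?K y)"
    proof (rule order.trans[OF integral_abs_bound integral_mono])
      fix y
      let ?x = "s * y"
      have "?G y = exp (\<eta> * y) * v y * exp (2 * z * ?x - ?x\<^sup>2)"
        by (simp add: algebra_simps exp_add exp_diff exp_minus divide_inverse)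
      moreover have "?S y = exp (\<eta> * y) * v y * (\<Sum>m<n. poly (hermite_poly m) z / fact m * ?x ^ m)"
        unfolding sum_distrib_left by (intro sum.cong) (auto simp: power_mult_distrib)
      ultimately have "\<bar>?G y - ?S y\<bar> = exp (\<eta> * y) * \<bar>v y\<bar> *
          \<bar>exp (2 * z * ?x - ?x\<^sup>2) - (\<Sum>m<n. poly (hermite_poly m) z / fact m * ?x ^ m)\<bar>"
        by (simp only: right_diff_distrib[symmetric] abs_mult abs_exp_cancel)
      also have "\<dots> \<le> exp (\<eta> * y) * \<bar>v y\<bar> * (exp (z\<^sup>2) * B * \<bar>?x\<bar> ^ n)"
        by (intro mult_left_mono B) auto
      also have "\<dots> = exp (z\<^sup>2) * B * \<bar>s\<bar> ^ n * ?K y"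
        by (simp add: abs_mult power_abs power_mult_distrib)
      finally show "\<bar>?G y - ?S y\<bar> \<le> exp (z\<^sup>2) * B * \<bar>s\<bar> ^ n * ?K y" .
    qed (use int in auto)
    also have "\<dots> = exp (z\<^sup>2) * B * \<bar>s\<bar> ^ n * (LINT y|lebesgue. ?K y)"
      by (rule integral_mult_right_zero)
    also have "\<dots> = exp (z\<^sup>2) * (B * (LINT y|lebesgue. ?K y)) * \<bar>s\<bar> ^ n"
      by (simp only: mult_ac)
    finally show "\<bar>bilateral_laplace (\<lambda>y. exp (- (s * y)\<^sup>2) * v y) (\<eta> + 2 * z * s)
      - (\<Sum>m<n. poly (hermite_poly m) z / fact m * s ^ m * bilateral_laplace (\<lambda>y. y ^ m * v y) \<eta>)\<bar>
      \<le> exp (z\<^sup>2) * (B * (LINT y|lebesgue. ?K y)) * \<bar>s\<bar> ^ n"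
      unfolding eq .
  qed
qed

text \<open>At \<open>z = h + b * s\<close> the zero of \<open>H_k\<close> at \<open>h\<close>
  lowers the term of order \<open>k\<close> to size \<open>s^(k+1)\<close>, where it competes with
  the term of order \<open>k + 1\<close>.\<close>

lemma gaussian_laplace_limit:
  fixes M :: "nat \<Rightarrow> real"
  assumes v: "all_exp_moments v"
    and M: "\<And>m. M m = bilateral_laplace (\<lambda>y. y ^ m * v y) \<eta>" "\<And>m. m < k \<Longrightarrow> M m = 0"
    and h: "poly (hermite_poly k) h = 0"
  shows "((\<lambda>s. bilateral_laplace (\<lambda>y. exp (- (s * y)\<^sup>2) * v y) (\<eta> + 2 * (h + b * s) * s) / s ^ (k + 1))
    \<longlongrightarrow> poly (pderiv (hermite_poly k)) h * (b * M k / fact k - M (k + 1) / fact (k + 1))) (at_right 0)"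
proof -
  let ?H = "\<lambda>m s. poly (hermite_poly m) (h + b * s)"
  let ?g = "\<lambda>s. bilateral_laplace (\<lambda>y. exp (- (s * y)\<^sup>2) * v y) (\<eta> + 2 * (h + b * s) * s)"
  \<comment> \<open>\<open>?P\<close> collects the two surviving terms of the expansion, divided by
    \<open>s^(k+1)\<close>. Expanding up to \<open>k + 2\<close> leaves a remainder with one spare
    factor \<open>s\<close>.\<close>
  let ?P = "\<lambda>s. ?H k s / s * (M k / fact k) + ?H (k + 1) s * (M (k + 1) / fact (k + 1))"
  obtain C where C: "\<And>z s. \<bar>bilateral_laplace (\<lambda>y. exp (- (s * y)\<^sup>2) * v y) (\<eta> + 2 * z * s)
      - (\<Sum>m<k + 2. poly (hermite_poly m) z / fact m * s ^ m * M m)\<bar> \<le> exp (z\<^sup>2) * C * \<bar>s\<bar> ^ (k + 2)"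
    using gaussian_laplace_expansion[OF v, of \<eta> "k + 2"] unfolding M(1) by blast
  have sum: "(\<Sum>m<k + 2. c m * M m) = c k * M k + c (k + 1) * M (k + 1)" for c :: "nat \<Rightarrow> real"
    using M(2) by (simp add: numeral_2_eq_2)
  have "((\<lambda>s. ?H k s) has_real_derivative poly (pderiv (hermite_poly k)) h * b) (at 0)"
    by (auto intro!: derivative_eq_intros DERIV_chain2[OF poly_DERIV])
  then have "((\<lambda>s. ?H k s / s) \<longlongrightarrow> poly (pderiv (hermite_poly k)) h * b) (at 0)"
    using h by (simp add: DERIV_def)
  then have lim_k: "((\<lambda>s. ?H k s / s) \<longlongrightarrow> poly (pderiv (hermite_poly k)) h * b) (at_right 0)"
    by (rule filterlim_mono) (simp_all add: at_le)
  have lim_Suc: "((\<lambda>s. ?H (k + 1) s) \<longlongrightarrow> poly (hermite_poly (k + 1)) h) (at_right 0)"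
    by (auto intro!: tendsto_eq_intros simp del: hermite_poly.simps)
  have lim_P: "(?P \<longlongrightarrow> poly (pderiv (hermite_poly k)) h * b * (M k / fact k)
      + poly (hermite_poly (k + 1)) h * (M (k + 1) / fact (k + 1))) (at_right 0)"
    by (intro tendsto_intros lim_k lim_Suc)
  have H_Suc: "poly (hermite_poly (k + 1)) h = - poly (pderiv (hermite_poly k)) h"
    using h by simp
  have "((\<lambda>s. ?g s / s ^ (k + 1) - ?P s) \<longlongrightarrow> 0) (at_right 0)"
  proof (rule Lim_null_comparison)
    show "\<forall>\<^sub>F s in at_right 0. norm (?g s / s ^ (k + 1) - ?P s) \<le> exp ((h + b * s)\<^sup>2) * C * s"
      unfolding eventually_at_right_field
    proof (intro exI[of _ 1] conjI allI impI)
      fix s :: real assume s: "0 < s" "s < 1"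
      let ?X = "?g s - (?H k s / fact k * s ^ k * M k + ?H (k + 1) s / fact (k + 1) * s ^ (k + 1) * M (k + 1))"
      have "?g s / s ^ (k + 1) - ?P s = ?X / s ^ (k + 1)"
        using s by (simp add: field_simps del: hermite_poly.simps fact_Suc)
      then have "norm (?g s / s ^ (k + 1) - ?P s) = \<bar>?X\<bar> / s ^ (k + 1)"
        using s by (simp del: hermite_poly.simps fact_Suc)
      moreover have "\<bar>?X\<bar> / s ^ (k + 1) \<le> exp ((h + b * s)\<^sup>2) * C * \<bar>s\<bar> ^ (k + 2) / s ^ (k + 1)"
        using C[of s "h + b * s"] s unfolding sum by (intro divide_right_mono) simp_all
      moreover have "\<dots> = exp ((h + b * s)\<^sup>2) * C * s"
        using s by simp
      ultimately show "norm (?g s / s ^ (k + 1) - ?P s) \<le> exp ((h + b * s)\<^sup>2) * C * s"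
        by linarith
    qed simp
    show "((\<lambda>s. exp ((h + b * s)\<^sup>2) * C * s) \<longlongrightarrow> 0) (at_right 0)"
      by (auto intro!: tendsto_eq_intros)
  qed
  from tendsto_add[OF this lim_P] show ?thesis
    unfolding H_Suc by (simp add: algebra_simps del: hermite_poly.simps fact_Suc)
qed

section \<open>Zeros of the heat solution near the predicted positions\<close>

lemma inverse_sqrt_at_right: "filterlim (\<lambda>t. 1 / (2 * sqrt t)) (at_right 0) at_top"
  unfolding filterlim_at
proof
  show "\<forall>\<^sub>F t in at_top. 1 / (2 * sqrt t) \<in> {0<..} \<and> 1 / (2 * sqrt t) \<noteq> 0"
    using eventually_gt_at_top[of 0] by eventually_elim simp
  show "((\<lambda>t. 1 / (2 * sqrt t)) \<longlongrightarrow> 0) at_top"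
    by (intro tendsto_divide_0[OF tendsto_const] filterlim_at_top_imp_at_infinity
        filterlim_tendsto_pos_mult_at_top[OF tendsto_const] sqrt_at_top) simp
qed

lemma zero_near_hermite_root:
  fixes M :: "nat \<Rightarrow> real"
  assumes v: "all_exp_moments v"
    and M: "\<And>m. M m = bilateral_laplace (\<lambda>y. y ^ m * v y) \<eta>" "\<And>m. m < k \<Longrightarrow> M m = 0" "M k \<noteq> 0"
    and h: "poly (hermite_poly k) h = 0" and "\<epsilon> > 0"
  shows "\<forall>\<^sub>F t in at_top. \<exists>x\<in>zero_level_set v t.
    \<bar>x - (2 * t * \<eta> + 2 * sqrt t * h + M (k + 1) / (real (k + 1) * M k))\<bar> < \<epsilon>"
proof -
  \<comment> \<open>The rescaled limit will be \<open>a * (b - c)\<close>, linear in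
    \<open>b\<close> with its only zero at \<open>c\<close>.\<close>
  define c where "c = M (k + 1) / (real (k + 1) * M k)"
  define a where "a = poly (pderiv (hermite_poly k)) h * (M k / fact k)"
  \<comment> \<open>The intermediate value theorem gives only a weak inequality with
    \<open>\<delta>\<close>; halving makes the final one strict.\<close>
  define \<delta> where "\<delta> = \<epsilon> / 2"
  define g where "g s b = bilateral_laplace (\<lambda>y. exp (- (s * y)\<^sup>2) * v y) (\<eta> + 2 * (h + b * s) * s)" for s b
  have "poly (pderiv (hermite_poly k)) h \<noteq> 0"
    using hermite_poly_no_common_root[OF h] h by simp
  then have "a \<noteq> 0" using M(3) by (simp add: a_def)
  have "\<delta> > 0" using \<open>\<epsilon> > 0\<close> by (simp add: \<delta>_def)
  have lim: "((\<lambda>s. g s b / s ^ (k + 1)) \<longlongrightarrow> a * (b - c)) (at_right 0)" for b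
  proof -
    have "a * (b - c) = poly (pderiv (hermite_poly k)) h * (b * M k / fact k - M (k + 1) / fact (k + 1))"
    proof -
      have "p * (m / f) * (n / (r * m)) = p * (n / (r * f))" if "m \<noteq> 0" for p m f n r :: real
        using that by simp
      from this[OF M(3)] have "a * c = poly (pderiv (hermite_poly k)) h * (M (k + 1) / fact (k + 1))"
        unfolding a_def c_def by (simp only: fact_Suc Suc_eq_plus1[symmetric] of_nat_mult)
      then show ?thesis
        unfolding right_diff_distrib by (simp add: a_def mult_ac del: fact_Suc)
    qed
    then show ?thesis
      unfolding g_def using gaussian_laplace_limit[OF v M(1,2) h] by simp
  qed
  \<comment> \<open>A negative product records opposite signs at \<open>c - \<delta>\<close> and
    \<open>c + \<delta>\<close> whatever the sign of \<open>a\<close>.\<close>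
  have "a * (c - \<delta> - c) * (a * (c + \<delta> - c)) = - ((a * \<delta>)\<^sup>2)"
    by (simp add: power2_eq_square)
  also have "\<dots> < 0"
    using \<open>a \<noteq> 0\<close> \<open>\<delta> > 0\<close> by simp
  finally have "\<forall>\<^sub>F s in at_right 0. (g s (c - \<delta>) / s ^ (k + 1)) * (g s (c + \<delta>) / s ^ (k + 1)) < 0"
    by (rule order_tendstoD(2)[OF tendsto_mult[OF lim lim]])
  then have "\<forall>\<^sub>F t in at_top. (let s = 1 / (2 * sqrt t) in
      (g s (c - \<delta>) / s ^ (k + 1)) * (g s (c + \<delta>) / s ^ (k + 1)) < 0)"
    unfolding Let_def by (rule eventually_compose_filterlim[OF _ inverse_sqrt_at_right])
  then show ?thesis
    using eventually_gt_at_top[of 0]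
  proof eventually_elim
    case (elim t)
    define s where "s = 1 / (2 * sqrt t)"
    have s: "s > 0" "4 * t * s = 2 * sqrt t" "4 * t * (s * s) = 1"
      using elim(2) by (auto simp: s_def field_simps)
    have "(g s (c - \<delta>) * g s (c + \<delta>)) / (s ^ (k + 1) * s ^ (k + 1)) < 0"
      using elim(1) unfolding Let_def s_def[symmetric] by simp
    then have sign: "g s (c - \<delta>) * g s (c + \<delta>) < 0"
      using s(1) by (simp add: divide_less_0_iff mult_less_0_iff not_less)
    have cont: "continuous_on A (g s)" for A
    proof -
      have "continuous_on UNIV (bilateral_laplace (\<lambda>y. exp (- (s * y)\<^sup>2) * v y))"
        using bilateral_laplace_derivative[OF all_exp_moments_times_gaussian[OF v]]
        by (intro continuous_at_imp_continuous_on) (auto intro: DERIV_isCont)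
      then show ?thesis
        unfolding g_def by (rule continuous_on_compose2) (auto intro!: continuous_intros)
    qed
    have "\<exists>b\<ge>c - \<delta>. b \<le> c + \<delta> \<and> g s b = 0"
    proof (cases "g s (c - \<delta>) < 0")
      case True
      then show ?thesis
        using sign \<open>\<delta> > 0\<close> by (intro IVT' cont) (auto simp: mult_less_0_iff)
    next
      case False
      then show ?thesis
        using sign \<open>\<delta> > 0\<close> by (intro IVT2' cont) (auto simp: mult_less_0_iff)
    qed
    then obtain b where b: "\<bar>b - c\<bar> \<le> \<delta>" "g s b = 0"
      by (metis abs_diff_le_iff)
    \<comment> \<open>Chosen so that \<open>x / (2 * t)\<close> is the argument of the transform in
      \<open>g s b\<close>. As \<open>4 * t * s^2 = 1\<close>, the shift \<open>b * s\<close> in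
      \<open>z\<close> becomes exactly \<open>b\<close> in \<open>x\<close>.\<close>
    define x where "x = 2 * t * (\<eta> + 2 * (h + b * s) * s)"
    have "x = 2 * t * \<eta> + 4 * t * s * h + 4 * t * (s * s) * b"
      by (simp add: x_def algebra_simps)
    then have "x - (2 * t * \<eta> + 2 * sqrt t * h + c) = b - c"
      unfolding s(2,3) by simp
    moreover have "x \<in> zero_level_set v t"
      using b(2) elim(2) heat_solution_eq_laplace[of t v x]
      by (simp add: zero_level_set_def g_def x_def s_def)
    moreover have "\<bar>b - c\<bar> < \<epsilon>"
      using b(1) \<open>\<epsilon> > 0\<close> by (simp add: \<delta>_def)
    ultimately show ?case
      unfolding c_def by metis
  qed
qed

text \<open>The nearby points supplied by \<open>ev\<close> depend on \<open>\<epsilon>\<close>. A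
  single function results from choosing, at each \<open>t\<close>, a point of \<open>Z t\<close>
  whose distance to \<open>a t\<close> is within \<open>1 / t\<close> of the infimum
  \<open>d t\<close>, since the infimum need not be attained.\<close>

lemma asymptotic_selection:
  fixes Z :: "real \<Rightarrow> real set"
  assumes ev: "\<And>\<epsilon>. \<epsilon> > 0 \<Longrightarrow> \<forall>\<^sub>F t in at_top. \<exists>x\<in>Z t. \<bar>x - a t\<bar> < \<epsilon>"
  shows "\<exists>x. (\<forall>\<^sub>F t in at_top. x t \<in> Z t) \<and> ((\<lambda>t. x t - a t) \<longlongrightarrow> 0) at_top"
proof -
  define d where "d t = (INF x\<in>Z t. \<bar>x - a t\<bar>)" for t
  have ne: "\<forall>\<^sub>F t in at_top. Z t \<noteq> {}"
    using ev[of 1] by (auto elim: eventually_mono)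
  have bdd: "bdd_below ((\<lambda>x. \<bar>x - a t\<bar>) ` Z t)" for t
    by (rule bdd_belowI[of _ 0]) auto
  have near: "\<exists>x\<in>Z t. \<bar>x - a t\<bar> < d t + 1 / t" if "Z t \<noteq> {}" "t > 0" for t
    using cINF_less_iff[OF that(1) bdd, of "d t + 1 / t"] that by (simp add: d_def)
  define x where "x t = (SOME x. x \<in> Z t \<and> \<bar>x - a t\<bar> < d t + 1 / t)" for t
  have x: "\<forall>\<^sub>F t in at_top. x t \<in> Z t \<and> \<bar>x t - a t\<bar> < d t + 1 / t"
    using ne eventually_gt_at_top[of 0]
  proof eventually_elim
    case (elim t)
    then show ?case
      unfolding x_def using someI_ex[of "\<lambda>x. x \<in> Z t \<and> \<bar>x - a t\<bar> < d t + 1 / t"] near[of t] by blast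
  qed
  have "((\<lambda>t. x t - a t) \<longlongrightarrow> 0) at_top"
  proof (rule tendstoI)
    fix e :: real assume "e > 0"
    have "\<forall>\<^sub>F t in at_top. 1 / t < e / 2"
      using \<open>e > 0\<close> by (intro order_tendstoD(2)[of _ 0] tendsto_divide_0[OF tendsto_const]
          filterlim_at_top_imp_at_infinity filterlim_ident) auto
    moreover have "\<forall>\<^sub>F t in at_top. \<exists>x\<in>Z t. \<bar>x - a t\<bar> < e / 2"
      using ev[of "e / 2"] \<open>e > 0\<close> by simp
    ultimately show "\<forall>\<^sub>F t in at_top. dist (x t - a t) 0 < e"
      using x
    proof eventually_elim
      case (elim t)
      then obtain y where "y \<in> Z t" "\<bar>y - a t\<bar> < e / 2" by blast
      then have "d t < e / 2"
        unfolding d_def using cINF_lower[OF bdd] by fastforce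
      then show ?case using elim by (simp add: dist_real_def)
    qed
  qed
  then show ?thesis
    using x by (auto elim: eventually_mono)
qed

section \<open>Assembly: enumerating the Hermite roots and selecting one branch for each\<close>

theorem theorem3p3:
  fixes u0 :: "real \<Rightarrow> real"
  assumes L1: "integrable lebesgue u0"
    and Linf: "\<exists>C. AE y in lebesgue. \<bar>u0 y\<bar> \<le> C"
    and nonzero: "(LINT y|lebesgue. \<bar>u0 y\<bar>) \<noteq> 0"
    and exp_decay: "\<forall>c::real. integrable lebesgue (\<lambda>y. exp (c * y) * \<bar>u0 y\<bar>)"
    and nonempty: "zero_set (bilateral_laplace u0) \<noteq> {}"
  shows "\<forall>\<eta> \<in> zero_set (bilateral_laplace u0). \<forall>k::nat.
    has_multiplicity (bilateral_laplace u0) \<eta> k \<longrightarrow>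
    (\<exists>h :: nat \<Rightarrow> real. bij_betw h {1..k} {z. hermite k z = 0} \<and>
      (\<exists>T>0. \<exists>x :: nat \<Rightarrow> real \<Rightarrow> real. \<forall>j\<in>{1..k}.
         (\<forall>t>T. x j t \<in> zero_level_set u0 t) \<and>
         (\<lambda>t. x j t - (2 * t * \<eta> + 2 * sqrt t * h j +
            (deriv ^^ (k + 1)) (bilateral_laplace u0) \<eta> /
            (real (k + 1) * (deriv ^^ k) (bilateral_laplace u0) \<eta>)))
           \<in> o[at_top](\<lambda>_. 1)))"
proof (intro ballI allI impI)
  fix \<eta> and k :: nat
  assume mult: "has_multiplicity (bilateral_laplace u0) \<eta> k"
  have v: "all_exp_moments u0"
    using L1 exp_decay by (simp add: all_exp_moments_def borel_measurable_integrable)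
  define M where "M m = (deriv ^^ m) (bilateral_laplace u0) \<eta>" for m
  have M: "M m = bilateral_laplace (\<lambda>y. y ^ m * u0 y) \<eta>" for m
    by (simp add: M_def higher_deriv_bilateral_laplace[OF v])
  have M0: "\<And>m. m < k \<Longrightarrow> M m = 0" "M k \<noteq> 0"
    using mult by (auto simp: has_multiplicity_def M_def)
  have "finite {z. hermite k z = 0}" "card {z. hermite k z = 0} = k"
    unfolding hermite_eq_poly by (auto simp: poly_roots_finite hermite_poly_nonzero card_roots_hermite_poly)
  then obtain h where h: "bij_betw h {1..k} {z. hermite k z = 0}"
    using ex_bij_betw_nat_finite_1 by metis
  let ?a = "\<lambda>j t. 2 * t * \<eta> + 2 * sqrt t * h j + M (k + 1) / (real (k + 1) * M k)"
  have "\<exists>x. \<forall>j\<in>{1..k}. (\<forall>\<^sub>F t in at_top. x j t \<in> zero_level_set u0 t) \<and>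
      ((\<lambda>t. x j t - ?a j t) \<longlongrightarrow> 0) at_top"
  proof (intro bchoice ballI asymptotic_selection zero_near_hermite_root[OF v M M0])
    fix j assume "j \<in> {1..k}"
    then show "poly (hermite_poly k) (h j) = 0"
      using bij_betwE[OF h] by (simp add: hermite_eq_poly)
  qed
  then obtain x where x: "\<And>j. j \<in> {1..k} \<Longrightarrow> \<forall>\<^sub>F t in at_top. x j t \<in> zero_level_set u0 t"
    "\<And>j. j \<in> {1..k} \<Longrightarrow> ((\<lambda>t. x j t - ?a j t) \<longlongrightarrow> 0) at_top"
    by blast
  \<comment> \<open>Only finitely many branches occur, so one threshold serves them all; it is
    raised to \<open>max T 1\<close> below to be positive.\<close>
  have "\<forall>\<^sub>F t in at_top. \<forall>j\<in>{1..k}. x j t \<in> zero_level_set u0 t"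
    using x(1) by (intro eventually_ball_finite) auto
  then obtain T where T: "\<And>t j. t \<ge> T \<Longrightarrow> j \<in> {1..k} \<Longrightarrow> x j t \<in> zero_level_set u0 t"
    unfolding eventually_at_top_linorder by blast
  have "(\<lambda>t. x j t - ?a j t) \<in> o[at_top](\<lambda>_. 1)" if "j \<in> {1..k}" for j
    using x(2)[OF that] by (intro smalloI_tendsto) auto
  then have "\<forall>j\<in>{1..k}. (\<forall>t>max T 1. x j t \<in> zero_level_set u0 t) \<and>
      (\<lambda>t. x j t - ?a j t) \<in> o[at_top](\<lambda>_. 1)"
    using T by auto
  moreover have "max T 1 > 0" by simp
  ultimately show "\<exists>h :: nat \<Rightarrow> real. bij_betw h {1..k} {z. hermite k z = 0} \<and>
      (\<exists>T>0. \<exists>x :: nat \<Rightarrow> real \<Rightarrow> real. \<forall>j\<in>{1..k}.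
         (\<forall>t>T. x j t \<in> zero_level_set u0 t) \<and>
         (\<lambda>t. x j t - (2 * t * \<eta> + 2 * sqrt t * h j +
            (deriv ^^ (k + 1)) (bilateral_laplace u0) \<eta> /
            (real (k + 1) * (deriv ^^ k) (bilateral_laplace u0) \<eta>)))
           \<in> o[at_top](\<lambda>_. 1))"
    using h unfolding M_def by blast
qed

end
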